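(* Let $A, B \in \mathbb{R}^{n \times n}$ be symmetric positive definite matrices and let all eigenvalues be numbered in ascending algebraic order. Then $$\lambda_k(A, \mathcal{L}(B)) \leq \lambda_k(A,B) \qquad \text{for all } 1 \leq k \leq n.$$
   Context: For symmetric $X, Y \in \mathbb{R}^{n\times n}$ with $Y$ positive definite, the generalized eigenvalues of the pencil $(X,Y)$ are the roots $\lambda$ of $\det(X-\lambda Y)=0$, counted with multiplicity; they are all real and are numbered in ascending order, $\lambda_1(X,Y) \le \dots \le \lambda_n(X,Y)$. The (row-sum) lumping operator $\mathcal{L} \colon \mathbb{R}^{n \times n} \to \mathbb{R}^{n \times n}$ is defined for $B=(b_{ij})$ by $\mathcal{L}(B)=\operatorname{diag}(d_1,\dots,d_n)$ with $d_i=\sum_{j=1}^n |b_{ij}|$ for $i=1,\dots,n$. *)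

theory Defs
  imports "HOL-Analysis.Analysis" "HOL-Computational_Algebra.Polynomial"
begin

definition symmetric_matrix :: "real ^ 'n ^ 'n \<Rightarrow> bool" where
  "symmetric_matrix A \<longleftrightarrow> transpose A = A"

definition positive_definite :: "real ^ 'n ^ 'n \<Rightarrow> bool" where
  "positive_definite A \<longleftrightarrow> (\<forall>x. x \<noteq> 0 \<longrightarrow> x \<bullet> (A *v x) > 0)"

(* det (X - t Y) as a polynomial in the indeterminate t; it is needed as a
   polynomial, not only as a function, so that its roots have multiplicities. *)
definition pencil_poly :: "real ^ 'n ^ 'n \<Rightarrow> real ^ 'n ^ 'n \<Rightarrow> real poly" where
  "pencil_poly X Y = det (\<chi> i j. [:X $ i $ j, - (Y $ i $ j):])"

lemma poly_pencil_poly: "poly (pencil_poly X Y) t = det (X - t *\<^sub>R Y)"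
  by (simp add: pencil_poly_def det_def poly_sum poly_prod algebra_simps)

(* The k-th entry, counted from 1, of the ascending list of the real roots of
   det (X - t Y), each root repeated according to its multiplicity.  If X is
   symmetric and Y symmetric positive definite, all n roots are real, so the list
   has length n; the definition is meant for such pencils and 1 \<le> k \<le> n. *)
definition gen_eigenvalue :: "nat \<Rightarrow> real ^ 'n ^ 'n \<Rightarrow> real ^ 'n ^ 'n \<Rightarrow> real" where
  "gen_eigenvalue k X Y = sorted_list_of_multiset (proots (pencil_poly X Y)) ! (k - 1)"

definition lumping :: "real ^ 'n ^ 'n \<Rightarrow> real ^ 'n ^ 'n" where
  "lumping B = (\<chi> i j. if i = j then (\<Sum>l\<in>UNIV. \<bar>B $ i $ l\<bar>) else 0)"

end

theory Submission
  imports Defs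
begin

text \<open>Since \<open>\<bar>b\<^sub>i\<^sub>j x\<^sub>i x\<^sub>j\<bar> \<le> \<bar>b\<^sub>i\<^sub>j\<bar> (x\<^sub>i\<^sup>2 + x\<^sub>j\<^sup>2) / 2\<close>, the quadratic form of a
  symmetric \<open>B\<close> is bounded by that of \<open>lumping B\<close> (\<open>quadratic_form_le_lumping\<close>). Enlarging the
  second matrix of a pencil whose first matrix is positive definite lowers every generalized
  eigenvalue (\<open>gen_eigenvalue_antimono\<close>).

  The latter is an inertia argument. By \<open>simultaneous_diagonalization\<close>, a symmetric pencil
  \<open>(X, Y)\<close> with \<open>Y\<close> positive definite is congruent to \<open>(diag d, I)\<close>, and the entries of \<open>d\<close> are
  then its generalized eigenvalues with multiplicity. Let \<open>e\<close> and \<open>d\<close> belong to \<open>(A, B)\<close> and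
  \<open>(A, C)\<close>, where \<open>B \<le> C\<close> as quadratic forms, and let \<open>c \<ge> 0\<close>. Then \<open>A \<le> c B \<le> c C\<close> on a subspace
  of dimension \<open>#{i. e\<^sub>i \<le> c}\<close>, whereas \<open>A > c C\<close> off the origin of a subspace of dimension
  \<open>#{i. d\<^sub>i > c}\<close>. These subspaces meet only in \<open>0\<close>, so \<open>#{i. e\<^sub>i \<le> c} \<le> #{i. d\<^sub>i \<le> c}\<close>, which
  orders the sorted lists of eigenvalues entrywise. Negative \<open>c\<close> need no attention, because \<open>A\<close> is
  positive definite and hence every \<open>e\<^sub>i\<close> is nonnegative.\<close>

section \<open>Symmetric bilinear forms\<close>

lemma symmetric_matrix_inner_commute:
  fixes X :: "real ^ 'n ^ 'n"
  assumes "symmetric_matrix X"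
  shows "v \<bullet> (X *v w) = w \<bullet> (X *v v)"
proof -
  have "v \<bullet> (X *v w) = (transpose X *v v) \<bullet> w" by (simp add: dot_lmul_matrix)
  also have "\<dots> = (X *v v) \<bullet> w" using assms by (simp only: symmetric_matrix_def)
  also have "\<dots> = w \<bullet> (X *v v)" by (rule inner_commute)
  finally show ?thesis .
qed

text \<open>A vector at which a quadratic form that is nonnegative on a subspace vanishes is orthogonal
  to the subspace with respect to the form: otherwise the form would take negative values on a line through the vector.\<close>

lemma nonneg_form_null_vector_orthogonal:
  fixes Z :: "real ^ 'n ^ 'n"
  assumes "symmetric_matrix Z" and "subspace S" and "v \<in> S" and "w \<in> S"
    and nonneg: "\<And>x. x \<in> S \<Longrightarrow> 0 \<le> x \<bullet> (Z *v x)" and null: "v \<bullet> (Z *v v) = 0"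
  shows "v \<bullet> (Z *v w) = 0"
proof (rule ccontr)
  define b q where "b = v \<bullet> (Z *v w)" and "q = w \<bullet> (Z *v w)"
  assume "v \<bullet> (Z *v w) \<noteq> 0"
  then have b: "b \<noteq> 0" by (simp add: b_def)
  have q: "q \<ge> 0" using nonneg assms(4) by (simp add: q_def)
  have line: "0 \<le> 2 * t * b + t\<^sup>2 * q" for t
  proof -
    have "v + t *\<^sub>R w \<in> S" using assms by (simp add: subspace_add subspace_scale)
    from nonneg[OF this] show ?thesis
      using null symmetric_matrix_inner_commute[OF assms(1), of w v]
      by (simp add: b_def q_def matrix_vector_right_distrib matrix_vector_mult_scaleR
          inner_add_left inner_add_right algebra_simps power2_eq_square)
  qed
  \<comment> \<open>The form on the line has its minimum at \<open>t = - b / q\<close> if \<open>q > 0\<close>; the denominator \<open>q + 1\<close>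
    also serves for \<open>q = 0\<close>.\<close>
  have "2 * (- b / (q + 1)) * b + (- b / (q + 1))\<^sup>2 * q = - (b\<^sup>2 * (q + 2)) / (q + 1)\<^sup>2"
    using q by (simp add: divide_simps power2_eq_square) (simp add: algebra_simps)
  moreover have "b\<^sup>2 * (q + 2) / (q + 1)\<^sup>2 > 0" using b q by (simp add: divide_simps)
  ultimately show False using line[of "- b / (q + 1)"] by simp
qed

text \<open>The generalized Rayleigh quotient attains its minimum \<open>\<mu>\<close> on the unit sphere of \<open>S\<close>, which is
  compact; \<open>v\<close> is a minimizer rescaled to unit length for \<open>Y\<close>.\<close>

lemma rayleigh_quotient_minimizer:
  fixes X Y :: "real ^ 'n ^ 'n"
  assumes Y: "positive_definite Y" and S: "subspace S" and "S \<noteq> {0}"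
  obtains v \<mu> where "v \<in> S" and "v \<bullet> (Y *v v) = 1" and "v \<bullet> (X *v v) = \<mu>"
    and "\<And>x. x \<in> S \<Longrightarrow> \<mu> * (x \<bullet> (Y *v x)) \<le> x \<bullet> (X *v x)"
proof -
  let ?f = "\<lambda>x. (x \<bullet> (X *v x)) / (x \<bullet> (Y *v x))"
  let ?U = "S \<inter> sphere 0 1"
  have pos: "x \<bullet> (Y *v x) > 0" if "x \<noteq> 0" for x
    using Y that by (auto simp: positive_definite_def)
  have unit: "(1 / norm x) *\<^sub>R x \<in> ?U" if "x \<in> S" "x \<noteq> 0" for x
    using that S by (simp add: subspace_scale)
  obtain z where "z \<in> S" "z \<noteq> 0" using S \<open>S \<noteq> {0}\<close> subspace_0 by blast
  then have ne: "?U \<noteq> {}" using unit by blast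
  have "compact ?U" by (intro closed_Int_compact closed_subspace S compact_sphere)
  moreover have "continuous_on ?U ?f"
  proof (intro continuous_intros ballI linear_continuous_on matrix_vector_mul_bounded_linear)
    fix x assume "x \<in> ?U"
    then have "x \<noteq> 0" by auto
    then show "x \<bullet> (Y *v x) \<noteq> 0" using pos[of x] by simp
  qed
  ultimately obtain u where u: "u \<in> ?U" and min: "\<And>x. x \<in> ?U \<Longrightarrow> ?f u \<le> ?f x"
    using continuous_attains_inf[OF _ ne] by blast
  define s where "s = u \<bullet> (Y *v u)"
  define v where "v = (1 / sqrt s) *\<^sub>R u"
  have "u \<noteq> 0" using u by auto
  then have s: "s > 0" using pos by (simp add: s_def)
  have scaled: "v \<bullet> (Z *v v) = (u \<bullet> (Z *v u)) / s" for Z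
    using s by (simp add: v_def matrix_vector_mult_scaleR)
  show ?thesis
  proof
    show "v \<in> S" using u S by (simp add: v_def subspace_scale)
    show "v \<bullet> (Y *v v) = 1" using s scaled s_def by simp
    show "v \<bullet> (X *v v) = ?f u" using scaled s_def by simp
    fix x assume "x \<in> S"
    show "?f u * (x \<bullet> (Y *v x)) \<le> x \<bullet> (X *v x)"
    proof (cases "x = 0")
      case False
      have "?f ((1 / norm x) *\<^sub>R x) = ?f x"
        using False by (simp add: matrix_vector_mult_scaleR)
      then have "?f u \<le> ?f x" using min[OF unit[OF \<open>x \<in> S\<close> False]] by simp
      then show ?thesis using pos[OF False] by (simp add: pos_le_divide_eq)
    qed simp
  qed
qed

section \<open>Simultaneous diagonalization\<close>

text \<open>Splitting off a minimizer of the Rayleigh quotient and passing to its \<open>Y\<close>-orthogonal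
  complement in \<open>S\<close> builds a basis of \<open>S\<close> that is orthonormal for \<open>Y\<close> and orthogonal for \<open>X\<close>.\<close>

lemma simultaneously_orthogonal_basis_subspace:
  fixes X Y :: "real ^ 'n ^ 'n"
  assumes X: "symmetric_matrix X" and Y: "symmetric_matrix Y" "positive_definite Y"
    and "subspace S"
  shows "\<exists>V. finite V \<and> V \<subseteq> S \<and> card V = dim S \<and>
    (\<forall>v\<in>V. \<forall>w\<in>V. v \<bullet> (Y *v w) = (if v = w then 1 else 0) \<and> (v \<noteq> w \<longrightarrow> v \<bullet> (X *v w) = 0))"
  using \<open>subspace S\<close>
proof (induction "dim S" arbitrary: S)
  case 0
  then show ?case by (intro exI[of _ "{}"]) auto
next
  case (Suc n)
  have "S \<noteq> {0}" using Suc.hyps(2) by (metis dim_singleton nat.distinct(1) dim_eq_0 order_refl)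
  then obtain v \<mu> where v: "v \<in> S" "v \<bullet> (Y *v v) = 1" "v \<bullet> (X *v v) = \<mu>"
    and min: "\<And>x. x \<in> S \<Longrightarrow> \<mu> * (x \<bullet> (Y *v x)) \<le> x \<bullet> (X *v x)"
    using rayleigh_quotient_minimizer[OF Y(2) Suc.prems] by metis
  define S' where "S' = {w \<in> S. v \<bullet> (Y *v w) = 0}"
  have S': "subspace S'"
    using Suc.prems unfolding S'_def subspace_def
    by (auto simp: matrix_vector_right_distrib matrix_vector_mult_scaleR inner_add_right)
  have X_orth: "v \<bullet> (X *v w) = 0" if "w \<in> S'" for w
  proof -
    let ?Z = "X - \<mu> *\<^sub>R Y"
    have Z: "x \<bullet> (?Z *v y) = x \<bullet> (X *v y) - \<mu> * (x \<bullet> (Y *v y))" for x y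
      by (simp add: matrix_vector_mult_diff_rdistrib scaleR_matrix_vector_assoc[symmetric]
          inner_diff_right)
    have "symmetric_matrix ?Z"
      using X Y(1) by (simp add: symmetric_matrix_def transpose_def vec_eq_iff)
    then have "v \<bullet> (?Z *v w) = 0"
      using Suc.prems v(1)
      by (rule nonneg_form_null_vector_orthogonal) (use that v min in \<open>auto simp: Z S'_def\<close>)
    then show ?thesis using that by (simp add: Z S'_def)
  qed
  have "span (insert v S') = S"
  proof
    show "span (insert v S') \<subseteq> S"
      using v(1) Suc.prems by (intro span_minimal) (auto simp: S'_def)
    show "S \<subseteq> span (insert v S')"
    proof
      fix x assume x: "x \<in> S"
      let ?w = "x - (v \<bullet> (Y *v x)) *\<^sub>R v"
      have "?w \<in> S'"
        using x v Suc.prems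
        by (simp add: S'_def subspace_diff subspace_scale matrix_vector_mult_diff_distrib
            matrix_vector_mult_scaleR inner_diff_right)
      then have "?w + (v \<bullet> (Y *v x)) *\<^sub>R v \<in> span (insert v S')"
        by (intro span_add span_scale) (auto intro: span_base)
      then show "x \<in> span (insert v S')" by simp
    qed
  qed
  then have "dim (insert v S') = dim S" by (metis dim_span)
  moreover have vnot: "v \<notin> S'" using v by (simp add: S'_def)
  then have "v \<notin> span S'" using S' by (metis span_eq_iff)
  ultimately have dim: "dim S = Suc (dim S')" by (simp add: dim_insert)
  then obtain V where V: "finite V" "V \<subseteq> S'" "card V = dim S'"
    "\<forall>x\<in>V. \<forall>w\<in>V. x \<bullet> (Y *v w) = (if x = w then 1 else 0) \<and> (x \<noteq> w \<longrightarrow> x \<bullet> (X *v w) = 0)"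
    using Suc.hyps S' by (metis Suc_inject)
  have cross: "v \<bullet> (Y *v w) = 0" "w \<bullet> (Y *v v) = 0" "v \<bullet> (X *v w) = 0" "w \<bullet> (X *v v) = 0"
    "w \<noteq> v" if "w \<in> V" for w
    using that V(2) vnot X_orth symmetric_matrix_inner_commute[OF X, of w v]
      symmetric_matrix_inner_commute[OF Y(1), of w v]
    by (auto simp: S'_def)
  show ?case
  proof (intro exI[of _ "insert v V"] conjI)
    show "insert v V \<subseteq> S" using v(1) V(2) by (auto simp: S'_def)
    show "card (insert v V) = dim S" using V vnot dim by (subst card_insert_disjoint) auto
    show "\<forall>x\<in>insert v V. \<forall>w\<in>insert v V. x \<bullet> (Y *v w) = (if x = w then 1 else 0) \<and>
        (x \<noteq> w \<longrightarrow> x \<bullet> (X *v w) = 0)"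
    proof (intro ballI)
      fix x w assume "x \<in> insert v V" "w \<in> insert v V"
      then consider "x = v" "w = v" | "x = v" "w \<in> V" | "x \<in> V" "w = v" | "x \<in> V" "w \<in> V"
        by blast
      then show "x \<bullet> (Y *v w) = (if x = w then 1 else 0) \<and> (x \<noteq> w \<longrightarrow> x \<bullet> (X *v w) = 0)"
        by cases (use V(4) v(2) cross in auto)
    qed
  qed (use V(1) in simp)
qed

text \<open>The columns of \<open>P\<close> are a basis of the whole space that is orthonormal for \<open>Y\<close> and orthogonal
  for \<open>X\<close>. The matrix of \<open>X\<close> in this basis is \<open>diag d\<close>.\<close>

lemma simultaneous_diagonalization:
  fixes X Y :: "real ^ 'n ^ 'n"
  assumes "symmetric_matrix X" and "symmetric_matrix Y" "positive_definite Y"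
  obtains P :: "real ^ 'n ^ 'n" and d :: "'n \<Rightarrow> real"
  where "transpose P ** Y ** P = mat 1"
    and "transpose P ** X ** P = (\<chi> i j. if i = j then d i else 0)"
proof -
  obtain V :: "(real ^ 'n) set" where V: "finite V" "card V = CARD('n)"
    "\<forall>v\<in>V. \<forall>w\<in>V. v \<bullet> (Y *v w) = (if v = w then 1 else 0) \<and> (v \<noteq> w \<longrightarrow> v \<bullet> (X *v w) = 0)"
    using simultaneously_orthogonal_basis_subspace[OF assms subspace_UNIV] by auto
  then obtain p where p: "bij_betw p (UNIV :: 'n set) V"
    using finite_same_card_bij[of "UNIV :: 'n set" V] by auto
  define P :: "real ^ 'n ^ 'n" where "P = (\<chi> i j. p j $ i)"
  have entry: "(transpose P ** Z ** P) $ i $ j = p i \<bullet> (Z *v p j)" for Z i j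
  proof -
    have "(transpose P ** (Z ** P)) $ i $ j = p i \<bullet> (Z *v p j)"
      by (simp add: P_def matrix_matrix_mult_def matrix_vector_mult_def transpose_def inner_vec_def)
    then show ?thesis by (simp add: matrix_mul_assoc)
  qed
  have "p i \<in> V" "p i = p j \<longleftrightarrow> i = j" for i j
    using p by (auto simp: bij_betw_def inj_on_def)
  then have orth: "p i \<bullet> (Y *v p j) = (if i = j then 1 else 0)"
    "i \<noteq> j \<Longrightarrow> p i \<bullet> (X *v p j) = 0" for i j
    using V(3) by metis+
  show ?thesis
  proof
    show "transpose P ** Y ** P = mat 1"
      by (simp add: vec_eq_iff entry mat_def orth)
    show "transpose P ** X ** P = (\<chi> i j. if i = j then p i \<bullet> (X *v p i) else 0)"
      by (simp add: vec_eq_iff entry orth)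
  qed
qed

section \<open>Spectrum of a diagonalized pencil\<close>

lemma congruence_quadratic_form:
  fixes P Z :: "real ^ 'n ^ 'n"
  shows "(P *v a) \<bullet> (Z *v (P *v a)) = a \<bullet> ((transpose P ** Z ** P) *v a)"
proof -
  have "(P *v a) \<bullet> y = a \<bullet> (transpose P *v y)" for y
    using dot_lmul_matrix[of y P a] by (simp add: inner_commute[of a] inner_commute[of "P *v a"])
  then show ?thesis
    by (simp add: matrix_vector_mul_assoc matrix_mul_assoc del: transpose_matrix_vector)
qed

lemma diagonal_quadratic_form:
  fixes a :: "real ^ 'n"
  shows "a \<bullet> ((\<chi> i j. if i = j then d i else 0) *v a) = (\<Sum>i\<in>UNIV. d i * (a $ i)\<^sup>2)"
proof -
  have "((\<chi> i j. if i = j then d i else 0) *v a) $ i = d i * a $ i" for i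
    by (simp add: matrix_vector_mult_def if_distrib[of "\<lambda>x. x * _"] cong: if_cong)
  then show ?thesis
    by (simp add: inner_vec_def power2_eq_square mult.left_commute)
qed

lemma mat_1_quadratic_form:
  fixes a :: "real ^ 'n"
  shows "a \<bullet> (mat 1 *v a) = (\<Sum>i\<in>UNIV. (a $ i)\<^sup>2)"
  by (simp add: inner_vec_def power2_eq_square)

text \<open>The entries of \<open>d\<close> are the generalized eigenvalues with multiplicity: congruence multiplies
  the characteristic polynomial of the pencil by \<open>(det P)\<^sup>2\<close>, which does not affect its roots.\<close>

lemma proots_pencil_poly_diagonalized:
  fixes X Y P :: "real ^ 'n ^ 'n"
  assumes "transpose P ** Y ** P = mat 1"
    and "transpose P ** X ** P = (\<chi> i j. if i = j then d i else 0)"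
  shows "proots (pencil_poly X Y) = image_mset d (mset_set UNIV)"
proof -
  have "det (transpose P) * det Y * det P = 1" using assms(1) by (metis det_I det_mul)
  then have detP: "det P \<noteq> 0" by auto
  let ?q = "\<lambda>i. smult (- 1) [:- d i, 1:]"
  have "poly (smult ((det P)\<^sup>2) (pencil_poly X Y)) t = poly (\<Prod>i\<in>UNIV. ?q i) t" for t
  proof -
    let ?D = "(\<chi> i j. if i = j then d i - t else 0) :: real ^ 'n ^ 'n"
    have entry: "(transpose P ** Z ** P) $ i $ j
        = (\<Sum>l\<in>UNIV. (\<Sum>k\<in>UNIV. P $ k $ i * Z $ k $ l) * P $ l $ j)" for Z i j
      by (simp add: matrix_matrix_mult_def transpose_def)
    have "transpose P ** (X - t *\<^sub>R Y) ** P
        = transpose P ** X ** P - t *\<^sub>R (transpose P ** Y ** P)"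
      by (simp add: vec_eq_iff entry sum_subtractf sum_distrib_left sum_distrib_right algebra_simps)
    also have "\<dots> = ?D" by (simp add: assms vec_eq_iff mat_def)
    finally have "det (transpose P) * det (X - t *\<^sub>R Y) * det P = det ?D" by (metis det_mul)
    also have "det ?D = (\<Prod>i\<in>UNIV. d i - t)" by (subst det_diagonal) auto
    finally show ?thesis
      by (simp add: poly_pencil_poly poly_prod power2_eq_square mult_ac)
  qed
  then have "smult ((det P)\<^sup>2) (pencil_poly X Y) = (\<Prod>i\<in>UNIV. ?q i)"
    by (simp add: poly_eq_poly_eq_iff[symmetric] fun_eq_iff)
  then have "proots (pencil_poly X Y) = proots (\<Prod>i\<in>UNIV. ?q i)"
    using detP by (metis power_not_zero proots_smult)
  also have "\<dots> = (\<Sum>i\<in>UNIV. proots (?q i))" by (rule proots_prod) auto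
  also have "\<dots> = (\<Sum>i\<in>UNIV. {#d i#})" by (subst proots_smult) simp_all
  also have "(\<Sum>i\<in>F. {#d i#}) = image_mset d (mset_set F)" if "finite F" for F
    using that by induction auto
  then have "(\<Sum>i\<in>UNIV. {#d i#}) = image_mset d (mset_set UNIV)" by simp
  finally show ?thesis .
qed

section \<open>Comparison of sorted multisets\<close>

text \<open>If \<open>M\<close> has at least as many elements up to each threshold as \<open>N\<close>, its sorted list is bounded
  entrywise by that of \<open>N\<close>. Only thresholds in \<open>N\<close> matter.\<close>

lemma sorted_list_of_multiset_nth_le:
  fixes M N :: "'a :: linorder multiset"
  assumes "size M = size N" and "j < size N"
    and "\<And>c. c \<in># N \<Longrightarrow> size (filter_mset (\<lambda>x. x \<le> c) N) \<le> size (filter_mset (\<lambda>x. x \<le> c) M)"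
  shows "sorted_list_of_multiset M ! j \<le> sorted_list_of_multiset N ! j"
proof (rule ccontr)
  let ?xs = "sorted_list_of_multiset M" and ?ys = "sorted_list_of_multiset N"
  have len: "length (sorted_list_of_multiset L) = size L" for L :: "'a multiset"
    by (metis mset_sorted_list_of_multiset size_mset)
  have sorted: "sorted ?xs" "sorted ?ys" by auto
  define c where "c = ?ys ! j"
  assume "\<not> ?xs ! j \<le> ?ys ! j"
  then have gt: "c < ?xs ! j" by (simp add: c_def)
  have count: "size (filter_mset (\<lambda>x. x \<le> c) L)
      = card {i. i < size L \<and> sorted_list_of_multiset L ! i \<le> c}" for L :: "'a multiset"
  proof -
    have "size (filter_mset (\<lambda>x. x \<le> c) L) = length (filter (\<lambda>x. x \<le> c) (sorted_list_of_multiset L))"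
      by (metis mset_filter mset_sorted_list_of_multiset size_mset)
    then show ?thesis by (simp add: length_filter_conv_card len)
  qed
  have "{..j} \<subseteq> {i. i < size N \<and> ?ys ! i \<le> c}"
    using assms(2) sorted len by (auto simp: c_def intro: sorted_nth_mono)
  then have "card {..j} \<le> size (filter_mset (\<lambda>x. x \<le> c) N)"
    unfolding count by (rule card_mono[rotated]) auto
  moreover have "c \<in># N"
    unfolding c_def using assms(2) len by (metis mset_sorted_list_of_multiset nth_mem_mset)
  moreover have "{i. i < size M \<and> ?xs ! i \<le> c} \<subseteq> {..<j}"
  proof
    fix i assume i: "i \<in> {i. i < size M \<and> ?xs ! i \<le> c}"
    have "\<not> j \<le> i"
    proof
      assume "j \<le> i"
      then have "?xs ! j \<le> ?xs ! i" using i sorted(1) len by (auto intro: sorted_nth_mono)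
      then show False using i gt by auto
    qed
    then show "i \<in> {..<j}" by simp
  qed
  then have "size (filter_mset (\<lambda>x. x \<le> c) M) \<le> card {..<j}"
    unfolding count by (rule card_mono[rotated]) auto
  ultimately show False using assms(3)[of c] by simp
qed

section \<open>Monotonicity in the second matrix\<close>

lemma dim_image_coordinate_subspace:
  fixes P :: "real ^ 'n ^ 'n"
  assumes "inj ((*v) P)"
  shows "dim ((*v) P ` {a. \<forall>i. i \<notin> K \<longrightarrow> a $ i = 0}) = card K"
proof -
  have "dim ((*v) P ` {a. \<forall>i. i \<notin> K \<longrightarrow> a $ i = 0}) = dim {a :: real ^ 'n. \<forall>i. i \<notin> K \<longrightarrow> a $ i = 0}"
    using assms by (intro dim_image_eq) (auto intro: inj_on_subset)
  then show ?thesis by (simp only: dim_substandard_cart flip: dim_vec_eq)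
qed

lemma inj_of_congruent_mat_1:
  fixes P :: "real ^ 'n ^ 'n"
  assumes "transpose P ** Y ** P = mat 1"
  shows "inj ((*v) P)"
proof (rule inj_on_inverseI)
  show "(transpose P ** Y) *v (P *v a) = a" for a
    by (simp only: matrix_vector_mul_assoc assms matrix_vector_mul_lid)
qed

text \<open>The image under \<open>P\<close> of the coordinate subspace of \<open>{i. e\<^sub>i \<le> c}\<close> and the image under \<open>Q\<close> of
  that of \<open>{i. d\<^sub>i > c}\<close> meet only in \<open>0\<close>, which bounds the sum of their dimensions. The sign of \<open>c\<close>
  is needed to pass from \<open>c B\<close> to \<open>c C\<close>.\<close>

lemma card_eigenvalues_le_mono:
  fixes A B C P Q :: "real ^ 'n ^ 'n"
  assumes PB: "transpose P ** B ** P = mat 1"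
    and PA: "transpose P ** A ** P = (\<chi> i j. if i = j then e i else 0)"
    and QC: "transpose Q ** C ** Q = mat 1"
    and QA: "transpose Q ** A ** Q = (\<chi> i j. if i = j then d i else 0)"
    and le: "\<And>x. x \<bullet> (B *v x) \<le> x \<bullet> (C *v x)" and "c \<ge> 0"
  shows "card {i. e i \<le> c} \<le> card {i. d i \<le> c}"
proof -
  define S where "S = (*v) P ` {a. \<forall>i. i \<notin> {i. e i \<le> c} \<longrightarrow> a $ i = 0}"
  define T where "T = (*v) Q ` {a. \<forall>i. i \<notin> {i. d i > c} \<longrightarrow> a $ i = 0}"
  have coord: "subspace {a :: real ^ 'n. \<forall>i. i \<notin> K \<longrightarrow> a $ i = 0}" for K
    by (auto simp: subspace_def)
  have ST: "subspace S" "subspace T"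
    unfolding S_def T_def by (intro linear_subspace_image coord matrix_vector_mul_linear)+
  have "S \<inter> T = {0}"
  proof
    show "S \<inter> T \<subseteq> {0}"
    proof
      fix x assume "x \<in> S \<inter> T"
      then have "x \<in> S" "x \<in> T" by auto
      obtain a where a: "x = P *v a" "\<And>i. \<not> e i \<le> c \<Longrightarrow> a $ i = 0"
        using \<open>x \<in> S\<close> by (auto simp: S_def)
      obtain b where b: "x = Q *v b" "\<And>i. \<not> d i > c \<Longrightarrow> b $ i = 0"
        using \<open>x \<in> T\<close> by (auto simp: T_def)
      have form_e: "x \<bullet> (B *v x) = (\<Sum>i\<in>UNIV. (a $ i)\<^sup>2)"
          "x \<bullet> (A *v x) = (\<Sum>i\<in>UNIV. e i * (a $ i)\<^sup>2)"
        unfolding a(1) congruence_quadratic_form PB PA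
        by (rule mat_1_quadratic_form diagonal_quadratic_form)+
      have form_d: "x \<bullet> (C *v x) = (\<Sum>i\<in>UNIV. (b $ i)\<^sup>2)"
          "x \<bullet> (A *v x) = (\<Sum>i\<in>UNIV. d i * (b $ i)\<^sup>2)"
        unfolding b(1) congruence_quadratic_form QC QA
        by (rule mat_1_quadratic_form diagonal_quadratic_form)+
      have "x \<bullet> (A *v x) \<le> c * (x \<bullet> (B *v x))"
        unfolding form_e sum_distrib_left
      proof (rule sum_mono)
        fix i show "e i * (a $ i)\<^sup>2 \<le> c * (a $ i)\<^sup>2"
          using a(2)[of i] by (cases "e i \<le> c") (auto intro: mult_right_mono)
      qed
      also have "\<dots> \<le> c * (x \<bullet> (C *v x))" using le \<open>c \<ge> 0\<close> by (rule mult_left_mono)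
      finally have "(\<Sum>i\<in>UNIV. (d i - c) * (b $ i)\<^sup>2) \<le> 0"
        unfolding form_d by (simp add: left_diff_distrib sum_subtractf sum_distrib_left)
      moreover have nonneg: "0 \<le> (d i - c) * (b $ i)\<^sup>2" for i
        using b(2)[of i] by (cases "d i > c") auto
      ultimately have "(\<Sum>i\<in>UNIV. (d i - c) * (b $ i)\<^sup>2) = 0"
        by (meson order_antisym sum_nonneg)
      then have zero: "(d i - c) * (b $ i)\<^sup>2 = 0" for i
        using nonneg by (subst (asm) sum_nonneg_eq_0_iff) auto
      have "b $ i = 0" for i using b(2)[of i] zero[of i] by (cases "d i > c") auto
      then have "b = 0" by (simp add: vec_eq_iff)
      then show "x \<in> {0}" by (simp add: b(1))
    qed
    show "{0} \<subseteq> S \<inter> T" using ST by (simp add: subspace_0)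
  qed
  then have "dim S + dim T = dim {x + y |x y. x \<in> S \<and> y \<in> T}"
    using dim_sums_Int[OF ST] by simp
  also have "\<dots> \<le> CARD('n)" by (rule dim_subset_UNIV_cart)
  finally have "card {i. e i \<le> c} + card {i. d i > c} \<le> CARD('n)"
    unfolding S_def T_def
      dim_image_coordinate_subspace[OF inj_of_congruent_mat_1[OF PB]]
      dim_image_coordinate_subspace[OF inj_of_congruent_mat_1[OF QC]] .
  moreover have "card {i. d i \<le> c} + card {i. d i > c} = CARD('n)"
  proof -
    have "{i. d i \<le> c} \<union> {i. d i > c} = UNIV" by auto
    moreover have "{i. d i \<le> c} \<inter> {i. d i > c} = {}" by auto
    ultimately show ?thesis using card_Un_disjoint[of "{i. d i \<le> c}" "{i. d i > c}"] by simp
  qed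
  ultimately show ?thesis by simp
qed

theorem gen_eigenvalue_antimono:
  fixes A B C :: "real ^ 'n ^ 'n"
  assumes A: "symmetric_matrix A" "positive_definite A"
    and B: "symmetric_matrix B" "positive_definite B"
    and C: "symmetric_matrix C"
    and le: "\<And>x. x \<bullet> (B *v x) \<le> x \<bullet> (C *v x)"
    and k: "1 \<le> k" "k \<le> CARD('n)"
  shows "gen_eigenvalue k A C \<le> gen_eigenvalue k A B"
proof -
  have Cpos: "positive_definite C"
    using B(2) le unfolding positive_definite_def by (meson less_le_trans)
  obtain P :: "real ^ 'n ^ 'n" and e where P: "transpose P ** B ** P = mat 1"
      "transpose P ** A ** P = (\<chi> i j. if i = j then e i else 0)"
    by (rule simultaneous_diagonalization[OF A(1) B])
  obtain Q :: "real ^ 'n ^ 'n" and d where Q: "transpose Q ** C ** Q = mat 1"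
      "transpose Q ** A ** Q = (\<chi> i j. if i = j then d i else 0)"
    by (rule simultaneous_diagonalization[OF A(1) C Cpos])
  have nonneg: "e i \<ge> 0" for i
  proof -
    have "e i = axis i 1 \<bullet> ((\<chi> i j. if i = j then e i else 0) *v axis i 1)"
      by (simp add: inner_axis' matrix_vector_mult_basis column_def)
    also have "\<dots> = (P *v axis i 1) \<bullet> (A *v (P *v axis i 1))"
      by (simp only: congruence_quadratic_form P(2))
    also have "\<dots> \<ge> 0"
      using A(2) unfolding positive_definite_def
      by (cases "P *v axis i 1 = 0") (auto intro: less_imp_le)
    finally show ?thesis .
  qed
  have count: "size (filter_mset (\<lambda>x. x \<le> c) (image_mset f (mset_set UNIV))) = card {i. f i \<le> c}"
    for f :: "'n \<Rightarrow> real" and c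
    by (simp add: filter_mset_image_mset filter_mset_mset_set)
  show ?thesis
    unfolding gen_eigenvalue_def proots_pencil_poly_diagonalized[OF P]
      proots_pencil_poly_diagonalized[OF Q]
  proof (rule sorted_list_of_multiset_nth_le)
    fix c assume "c \<in># image_mset e (mset_set UNIV)"
    then have "c \<ge> 0" using nonneg by auto
    then show "size (filter_mset (\<lambda>x. x \<le> c) (image_mset e (mset_set UNIV)))
        \<le> size (filter_mset (\<lambda>x. x \<le> c) (image_mset d (mset_set UNIV)))"
      unfolding count by (rule card_eigenvalues_le_mono[OF P Q le])
  qed (use k in auto)
qed

section \<open>Lumping\<close>

lemma symmetric_matrix_lumping: "symmetric_matrix (lumping B)"
  by (auto simp: symmetric_matrix_def lumping_def transpose_def vec_eq_iff)

lemma quadratic_form_le_lumping: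
  fixes B :: "real ^ 'n ^ 'n"
  assumes "symmetric_matrix B"
  shows "x \<bullet> (B *v x) \<le> x \<bullet> (lumping B *v x)"
proof -
  have sym: "B $ j $ i = B $ i $ j" for i j
    using assms by (simp add: symmetric_matrix_def transpose_def vec_eq_iff)
  have term_le: "x $ i * (B $ i $ j * x $ j)
      \<le> (\<bar>B $ i $ j\<bar> * (x $ i)\<^sup>2 + \<bar>B $ i $ j\<bar> * (x $ j)\<^sup>2) / 2" for i j
  proof -
    have "x $ i * (B $ i $ j * x $ j) \<le> \<bar>B $ i $ j\<bar> * (\<bar>x $ i\<bar> * \<bar>x $ j\<bar>)"
      using abs_ge_self[of "x $ i * (B $ i $ j * x $ j)"] by (simp add: abs_mult mult.left_commute)
    also have "\<dots> \<le> \<bar>B $ i $ j\<bar> * (((x $ i)\<^sup>2 + (x $ j)\<^sup>2) / 2)"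
      using sum_squares_bound[of "\<bar>x $ i\<bar>" "\<bar>x $ j\<bar>"] by (intro mult_left_mono) auto
    finally show ?thesis by (simp add: algebra_simps)
  qed
  let ?R = "\<Sum>i\<in>UNIV. \<Sum>j\<in>UNIV. \<bar>B $ i $ j\<bar> * (x $ i)\<^sup>2"
  have "x \<bullet> (B *v x) = (\<Sum>i\<in>UNIV. \<Sum>j\<in>UNIV. x $ i * (B $ i $ j * x $ j))"
    by (simp add: inner_vec_def matrix_vector_mult_def sum_distrib_left)
  also have "\<dots> \<le> (\<Sum>i\<in>UNIV. \<Sum>j\<in>UNIV.
      (\<bar>B $ i $ j\<bar> * (x $ i)\<^sup>2 + \<bar>B $ i $ j\<bar> * (x $ j)\<^sup>2) / 2)"
    by (intro sum_mono term_le)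
  also have "\<dots> = (?R + (\<Sum>i\<in>UNIV. \<Sum>j\<in>UNIV. \<bar>B $ i $ j\<bar> * (x $ j)\<^sup>2)) / 2"
    by (simp add: sum.distrib flip: sum_divide_distrib)
  also have "(\<Sum>i\<in>UNIV. \<Sum>j\<in>UNIV. \<bar>B $ i $ j\<bar> * (x $ j)\<^sup>2) = ?R"
    by (subst sum.swap) (simp add: sym)
  also have "(?R + ?R) / 2 = ?R" by simp
  also have "?R = x \<bullet> (lumping B *v x)"
    unfolding lumping_def diagonal_quadratic_form by (simp add: sum_distrib_right)
  finally show ?thesis .
qed

theorem corollary3p10:
  fixes A B :: "real ^ 'n ^ 'n" and k :: nat
  assumes "symmetric_matrix A" and "positive_definite A"
    and "symmetric_matrix B" and "positive_definite B"
    and "1 \<le> k" and "k \<le> CARD('n)"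
  shows "gen_eigenvalue k A (lumping B) \<le> gen_eigenvalue k A B"
  using assms quadratic_form_le_lumping
  by (intro gen_eigenvalue_antimono symmetric_matrix_lumping) auto

end
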